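(* The assignment $(X,\trianglelefteq)\mapsto(\mathcal{O}X,\operatorname{im}(\Uparrow),\operatorname{im}(\Downarrow))$ on objects and $f\mapsto f^{-1}$ on morphisms is an isomorphism of categories $$\{\text{convex ordered locales satisfying (C-}\trianglelefteq\text{) and (C-}\vee\text{), with monotone maps}\}\;\cong\;\{\text{reflective biframes, with biframe maps}\}^{\mathrm{op}}.$$
   Context: A locale $X$ is given by a frame $\mathcal{O}X$ (order $\sqsubseteq$); a map of locales $f\colon X\to Y$ is a frame homomorphism $f^{-1}\colon\mathcal{O}Y\to\mathcal{O}X$. Ordered locale: a pair $(X,\trianglelefteq)$ of a locale $X$ and a preorder $\trianglelefteq$ on $\mathcal{O}X$ such that $U_i\trianglelefteq V_i$ for all $i\in I$ implies $\bigvee_iU_i\trianglelefteq\bigvee_iV_i$ (any index set). Localic cones: $\Uparrow U=\bigvee\{V: U\trianglelefteq V\}$, $\Downarrow U=\bigvee\{W: W\trianglelefteq U\}$. Images: $\operatorname{im}(\Uparrow)=\{\Uparrow U:U\in\mathcal{O}X\}$, $\operatorname{im}(\Downarrow)=\{\Downarrow U:U\in\mathcal{O}X\}$. (C-$\trianglelefteq$): $U\trianglelefteq V$ if and only if $U\sqsubseteq\Downarrow V$ and $V\sqsubseteq\Uparrow U$. (C-$\vee$): $\Uparrow$ and $\Downarrow$ preserve arbitrary joins. Convex: every $U\in\mathcal{O}X$ is a join of elements of the form $\Uparrow V\wedge\Downarrow W$. Monotone map: a map of locales $f\colon X\to Y$ between ordered locales is monotone if (upper) whenever $U\trianglelefteq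 U'$ in $\mathcal{O}X$ and $U\sqsubseteq f^{-1}(V)$ there is $V'$ with $V\trianglelefteq V'$ and $U'\sqsubseteq f^{-1}(V')$; and (lower) whenever $U\trianglelefteq U'$ and $U'\sqsubseteq f^{-1}(V')$ there is $V$ with $V\trianglelefteq V'$ and $U\sqsubseteq f^{-1}(V)$. Biframe: a triple $(L_0,L_1,L_2)$ of frames with $L_1,L_2\subseteq L_0$ subframes (closed under finite meets and arbitrary joins) such that every $x\in L_0$ is a join of elements $y\wedge z$ with $y\in L_1$, $z\in L_2$. Biframe map $(L_0,L_1,L_2)\to(M_0,M_1,M_2)$: a frame homomorphism $h\colon L_0\to M_0$ with $h(L_i)\subseteq M_i$ for $i=1,2$. A biframe is reflective if both inclusions $L_1,L_2\hookrightarrow L_0$ have left Galois adjoints. *)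

theory Defs
  imports "HOL-Algebra.Galois_Connection"
begin

section \<open>Categories, functors and isomorphisms of categories\<close>

text \<open>
  Hom-sets of different pairs of objects need not be disjoint, so composition, as well as the
  action of a functor on morphisms, takes the objects involved as arguments:
  \<open>Comp C X Y Z g f\<close> is the composite of \<open>f : X \<rightarrow> Y\<close> and \<open>g : Y \<rightarrow> Z\<close>.
\<close>

record ('o, 'm) cat =
  Ob :: "'o set"
  Hom :: "'o \<Rightarrow> 'o \<Rightarrow> 'm set"
  Ident :: "'o \<Rightarrow> 'm"
  Comp :: "'o \<Rightarrow> 'o \<Rightarrow> 'o \<Rightarrow> 'm \<Rightarrow> 'm \<Rightarrow> 'm"

locale category =
  fixes C :: "('o, 'm) cat"
  assumes Ident_in_Hom: "X \<in> Ob C \<Longrightarrow> Ident C X \<in> Hom C X X"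
    and Comp_in_Hom:
      "\<lbrakk>X \<in> Ob C; Y \<in> Ob C; Z \<in> Ob C; f \<in> Hom C X Y; g \<in> Hom C Y Z\<rbrakk>
        \<Longrightarrow> Comp C X Y Z g f \<in> Hom C X Z"
    and Comp_Ident_right:
      "\<lbrakk>X \<in> Ob C; Y \<in> Ob C; f \<in> Hom C X Y\<rbrakk> \<Longrightarrow> Comp C X X Y f (Ident C X) = f"
    and Comp_Ident_left:
      "\<lbrakk>X \<in> Ob C; Y \<in> Ob C; f \<in> Hom C X Y\<rbrakk> \<Longrightarrow> Comp C X Y Y (Ident C Y) f = f"
    and Comp_assoc:
      "\<lbrakk>W \<in> Ob C; X \<in> Ob C; Y \<in> Ob C; Z \<in> Ob C;
        f \<in> Hom C W X; g \<in> Hom C X Y; h \<in> Hom C Y Z\<rbrakk>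
        \<Longrightarrow> Comp C W Y Z h (Comp C W X Y g f) = Comp C W X Z (Comp C X Y Z h g) f"

definition op_cat :: "('o, 'm) cat \<Rightarrow> ('o, 'm) cat" where
  "op_cat C = \<lparr>Ob = Ob C, Hom = (\<lambda>X Y. Hom C Y X), Ident = Ident C,
     Comp = (\<lambda>X Y Z g f. Comp C Z Y X f g)\<rparr>"

locale cat_functor = C: category C + D: category D
  for C :: "('o1, 'm1) cat" and D :: "('o2, 'm2) cat" +
  fixes Fo :: "'o1 \<Rightarrow> 'o2" and Fm :: "'o1 \<Rightarrow> 'o1 \<Rightarrow> 'm1 \<Rightarrow> 'm2"
  assumes Fo_in_Ob: "X \<in> Ob C \<Longrightarrow> Fo X \<in> Ob D"
    and Fm_in_Hom:
      "\<lbrakk>X \<in> Ob C; Y \<in> Ob C; f \<in> Hom C X Y\<rbrakk> \<Longrightarrow> Fm X Y f \<in> Hom D (Fo X) (Fo Y)"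
    and Fm_Ident: "X \<in> Ob C \<Longrightarrow> Fm X X (Ident C X) = Ident D (Fo X)"
    and Fm_Comp:
      "\<lbrakk>X \<in> Ob C; Y \<in> Ob C; Z \<in> Ob C; f \<in> Hom C X Y; g \<in> Hom C Y Z\<rbrakk>
        \<Longrightarrow> Fm X Z (Comp C X Y Z g f) = Comp D (Fo X) (Fo Y) (Fo Z) (Fm Y Z g) (Fm X Y f)"

definition cat_isomorphism ::
  "('o1, 'm1) cat \<Rightarrow> ('o2, 'm2) cat \<Rightarrow> ('o1 \<Rightarrow> 'o2) \<Rightarrow> ('o1 \<Rightarrow> 'o1 \<Rightarrow> 'm1 \<Rightarrow> 'm2) \<Rightarrow> bool" where
  "cat_isomorphism C D Fo Fm \<longleftrightarrow>
     cat_functor C D Fo Fm \<and>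
     (\<exists>Go Gm. cat_functor D C Go Gm \<and>
        (\<forall>X\<in>Ob C. Go (Fo X) = X) \<and>
        (\<forall>X\<in>Ob C. \<forall>Y\<in>Ob C. \<forall>f\<in>Hom C X Y. Gm (Fo X) (Fo Y) (Fm X Y f) = f) \<and>
        (\<forall>X\<in>Ob D. Fo (Go X) = X) \<and>
        (\<forall>X\<in>Ob D. \<forall>Y\<in>Ob D. \<forall>f\<in>Hom D X Y. Fm (Go X) (Go Y) (Gm X Y f) = f))"


section \<open>Frames\<close>

text \<open>
  The condition \<open>le_in_carrier\<close> removes the freedom in the values of the order outside the
  carrier, so that equality of records is equality of frames (isomorphisms of categories are
  sensitive to this).  For the same reason frame homomorphisms are required to be undefined
  outside the carrier of their domain.
\<close>

locale frame = complete_lattice L for L :: "'a gorder" (structure) +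
  assumes le_in_carrier: "x \<sqsubseteq> y \<Longrightarrow> x \<in> carrier L \<and> y \<in> carrier L"
    and meet_Sup_distrib:
      "\<lbrakk>x \<in> carrier L; A \<subseteq> carrier L\<rbrakk> \<Longrightarrow> x \<sqinter> \<Squnion>A = \<Squnion>((\<lambda>a. x \<sqinter> a) ` A)"

definition frame_homs :: "'a gorder \<Rightarrow> 'b gorder \<Rightarrow> ('a \<Rightarrow> 'b) set" where
  "frame_homs L M = {h \<in> carrier L \<rightarrow>\<^sub>E carrier M.
     h \<top>\<^bsub>L\<^esub> = \<top>\<^bsub>M\<^esub> \<and>
     (\<forall>x\<in>carrier L. \<forall>y\<in>carrier L. h (x \<sqinter>\<^bsub>L\<^esub> y) = h x \<sqinter>\<^bsub>M\<^esub> h y) \<and>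
     (\<forall>A. A \<subseteq> carrier L \<longrightarrow> h (\<Squnion>\<^bsub>L\<^esub>A) = \<Squnion>\<^bsub>M\<^esub>(h ` A))}"

definition subframe :: "'a set \<Rightarrow> 'a gorder \<Rightarrow> bool" where
  "subframe S L \<longleftrightarrow> S \<subseteq> carrier L \<and> \<top>\<^bsub>L\<^esub> \<in> S \<and>
     (\<forall>x\<in>S. \<forall>y\<in>S. x \<sqinter>\<^bsub>L\<^esub> y \<in> S) \<and> (\<forall>A. A \<subseteq> S \<longrightarrow> \<Squnion>\<^bsub>L\<^esub>A \<in> S)"


section \<open>Ordered locales\<close>

text \<open>
  An ordered locale is a pair \<open>(L, T)\<close> of the frame \<open>L\<close> of opens and the preorder \<open>T\<close>,
  given as a set of pairs.
\<close>

type_synonym 'a ordered_loc = "'a gorder \<times> 'a rel"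

text \<open>
  A family of related pairs \<open>U\<^sub>i\<close>, \<open>V\<^sub>i\<close> over an arbitrary index set is, up to
  repetitions (which do not affect joins), a subset \<open>S\<close> of \<open>T\<close>.
\<close>

definition ordered_locale :: "'a ordered_loc \<Rightarrow> bool" where
  "ordered_locale = (\<lambda>(L, T). frame L \<and> preorder_on (carrier L) T \<and>
     (\<forall>S. S \<subseteq> T \<longrightarrow> (\<Squnion>\<^bsub>L\<^esub>(fst ` S), \<Squnion>\<^bsub>L\<^esub>(snd ` S)) \<in> T))"

definition up_cone :: "'a ordered_loc \<Rightarrow> 'a \<Rightarrow> 'a" where
  "up_cone = (\<lambda>(L, T) U. \<Squnion>\<^bsub>L\<^esub>{V. (U, V) \<in> T})"

definition down_cone :: "'a ordered_loc \<Rightarrow> 'a \<Rightarrow> 'a" where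
  "down_cone = (\<lambda>(L, T) U. \<Squnion>\<^bsub>L\<^esub>{W. (W, U) \<in> T})"

definition im_up :: "'a ordered_loc \<Rightarrow> 'a set" where
  "im_up X = up_cone X ` carrier (fst X)"

definition im_down :: "'a ordered_loc \<Rightarrow> 'a set" where
  "im_down X = down_cone X ` carrier (fst X)"

definition C_order :: "'a ordered_loc \<Rightarrow> bool" where
  "C_order = (\<lambda>(L, T). \<forall>U\<in>carrier L. \<forall>V\<in>carrier L.
     (U, V) \<in> T \<longleftrightarrow> U \<sqsubseteq>\<^bsub>L\<^esub> down_cone (L, T) V \<and> V \<sqsubseteq>\<^bsub>L\<^esub> up_cone (L, T) U)"

definition C_join :: "'a ordered_loc \<Rightarrow> bool" where
  "C_join = (\<lambda>(L, T). \<forall>A. A \<subseteq> carrier L \<longrightarrow>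
     up_cone (L, T) (\<Squnion>\<^bsub>L\<^esub>A) = \<Squnion>\<^bsub>L\<^esub>(up_cone (L, T) ` A) \<and>
     down_cone (L, T) (\<Squnion>\<^bsub>L\<^esub>A) = \<Squnion>\<^bsub>L\<^esub>(down_cone (L, T) ` A))"

definition convex_ordered :: "'a ordered_loc \<Rightarrow> bool" where
  "convex_ordered = (\<lambda>(L, T). \<forall>U\<in>carrier L.
     \<exists>S. S \<subseteq> {up_cone (L, T) V \<sqinter>\<^bsub>L\<^esub> down_cone (L, T) W | V W. V \<in> carrier L \<and> W \<in> carrier L}
        \<and> U = \<Squnion>\<^bsub>L\<^esub>S)"

text \<open>
  A map of locales \<open>X \<rightarrow> Y\<close> is represented by its frame homomorphism, from the opens
  of \<open>Y\<close> to the opens of \<open>X\<close>.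
\<close>

definition locale_maps :: "'a ordered_loc \<Rightarrow> 'a ordered_loc \<Rightarrow> ('a \<Rightarrow> 'a) set" where
  "locale_maps X Y = frame_homs (fst Y) (fst X)"

definition inverse_image :: "'a ordered_loc \<Rightarrow> 'a ordered_loc \<Rightarrow> ('a \<Rightarrow> 'a) \<Rightarrow> ('a \<Rightarrow> 'a)" where
  "inverse_image X Y f = f"

definition monotone_map :: "'a ordered_loc \<Rightarrow> 'a ordered_loc \<Rightarrow> ('a \<Rightarrow> 'a) \<Rightarrow> bool" where
  "monotone_map = (\<lambda>(L, T) (M, R) f.
     (\<forall>U U' V. (U, U') \<in> T \<and> V \<in> carrier M \<and> U \<sqsubseteq>\<^bsub>L\<^esub> inverse_image (L, T) (M, R) f V \<longrightarrow>
        (\<exists>V'. (V, V') \<in> R \<and> U' \<sqsubseteq>\<^bsub>L\<^esub> inverse_image (L, T) (M, R) f V')) \<and>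
     (\<forall>U U' V'. (U, U') \<in> T \<and> V' \<in> carrier M \<and> U' \<sqsubseteq>\<^bsub>L\<^esub> inverse_image (L, T) (M, R) f V' \<longrightarrow>
        (\<exists>V. (V, V') \<in> R \<and> U \<sqsubseteq>\<^bsub>L\<^esub> inverse_image (L, T) (M, R) f V)))"

definition convex_ordered_locale_cat :: "('a ordered_loc, 'a \<Rightarrow> 'a) cat" where
  "convex_ordered_locale_cat = \<lparr>
     Ob = {X. ordered_locale X \<and> convex_ordered X \<and> C_order X \<and> C_join X},
     Hom = (\<lambda>X Y. {f \<in> locale_maps X Y. monotone_map X Y f}),
     Ident = (\<lambda>X. \<lambda>x\<in>carrier (fst X). x),
     Comp = (\<lambda>X Y Z g f. compose (carrier (fst Z)) f g)\<rparr>"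


section \<open>Biframes\<close>

type_synonym 'a biframe_triple = "'a gorder \<times> 'a set \<times> 'a set"

definition biframe :: "'a biframe_triple \<Rightarrow> bool" where
  "biframe = (\<lambda>(L0, L1, L2). frame L0 \<and> subframe L1 L0 \<and> subframe L2 L0 \<and>
     (\<forall>x\<in>carrier L0. \<exists>S. S \<subseteq> {y \<sqinter>\<^bsub>L0\<^esub> z | y z. y \<in> L1 \<and> z \<in> L2} \<and> x = \<Squnion>\<^bsub>L0\<^esub>S))"

definition inclusion_has_left_adjoint :: "'a set \<Rightarrow> 'a gorder \<Rightarrow> bool" where
  "inclusion_has_left_adjoint S L \<longleftrightarrow>
     (\<exists>l. galois_connection \<lparr>orderA = L, orderB = L\<lparr>carrier := S\<rparr>, lower = l, upper = id\<rparr>)"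

definition reflective :: "'a biframe_triple \<Rightarrow> bool" where
  "reflective = (\<lambda>(L0, L1, L2).
     inclusion_has_left_adjoint L1 L0 \<and> inclusion_has_left_adjoint L2 L0)"

definition biframe_maps :: "'a biframe_triple \<Rightarrow> 'a biframe_triple \<Rightarrow> ('a \<Rightarrow> 'a) set" where
  "biframe_maps = (\<lambda>(L0, L1, L2) (M0, M1, M2).
     {h \<in> frame_homs L0 M0. h ` L1 \<subseteq> M1 \<and> h ` L2 \<subseteq> M2})"

definition reflective_biframe_cat :: "('a biframe_triple, 'a \<Rightarrow> 'a) cat" where
  "reflective_biframe_cat = \<lparr>
     Ob = {B. biframe B \<and> reflective B},
     Hom = biframe_maps,
     Ident = (\<lambda>B. \<lambda>x\<in>carrier (fst B). x),
     Comp = (\<lambda>A B C g f. compose (carrier (fst A)) g f)\<rparr>"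

end

theory Submission
  imports Defs
begin

text \<open>
  For an ordered locale with (C-\<open>\<or>\<close>) the cone \<open>\<Up>U\<close> is the largest open \<open>V\<close> with \<open>U \<unlhd> V\<close>, so
  \<open>\<Up>\<close> is a join-preserving closure operator; its image is therefore a subframe, and \<open>\<Up>\<close> is left
  adjoint to the inclusion of that image.  The same holds for \<open>\<Down>\<close>.  Conversely, left adjoints
  \<open>u\<close> and \<open>d\<close> to the inclusions of a reflective biframe yield the preorder
  \<open>U \<unlhd> V \<longleftrightarrow> U \<sqsubseteq> d V \<and> V \<sqsubseteq> u U\<close>, whose cones are \<open>u\<close> and \<open>d\<close>.  By uniqueness of adjoints and
  (C-\<open>\<unlhd>\<close>) the two constructions are mutually inverse.  A frame homomorphism
  satisfies the upper (lower) monotonicity condition iff it preserves the fixed points of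
  \<open>\<Up>\<close> (\<open>\<Down>\<close>), so the hom-sets on both sides are equal.
\<close>

section \<open>Reflective subsets of frames\<close>

lemma (in complete_lattice) Sup_mono_family:
  assumes "f ` I \<subseteq> carrier L" "g ` I \<subseteq> carrier L" "\<And>i. i \<in> I \<Longrightarrow> f i \<sqsubseteq> g i"
  shows "\<Squnion>(f ` I) \<sqsubseteq> \<Squnion>(g ` I)"
proof (rule sup_least[OF assms(1)])
  show "\<Squnion>(g ` I) \<in> carrier L" using assms(2) by simp
  fix z assume "z \<in> f ` I"
  then obtain i where i: "i \<in> I" "z = f i" by auto
  have "g i \<sqsubseteq> \<Squnion>(g ` I)" using i assms(2) by (intro sup_upper) auto
  then show "z \<sqsubseteq> \<Squnion>(g ` I)"
    using i assms le_trans[of "f i" "g i" "\<Squnion>(g ` I)"] by (simp add: image_subset_iff)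
qed

lemma frame_homs_mono:
  assumes "frame L" "frame M" "h \<in> frame_homs L M" "x \<in> carrier L" "y \<in> carrier L" "x \<sqsubseteq>\<^bsub>L\<^esub> y"
  shows "h x \<sqsubseteq>\<^bsub>M\<^esub> h y"
proof -
  interpret L: frame L by fact
  interpret M: frame M by fact
  have c: "h x \<in> carrier M" "h y \<in> carrier M"
    using assms(3-5) by (auto simp: frame_homs_def)
  have "h (x \<sqinter>\<^bsub>L\<^esub> y) = h x \<sqinter>\<^bsub>M\<^esub> h y"
    using assms(3-5) by (simp add: frame_homs_def)
  \<comment> \<open>\<open>le_iff_join\<close> expresses the order through the binary meet, in spite
    of its name.\<close>
  moreover have "x \<sqinter>\<^bsub>L\<^esub> y = x"
    by (rule L.le_iff_join[THEN iffD1, symmetric]) (use assms(4-6) in auto)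
  ultimately have "h x \<sqinter>\<^bsub>M\<^esub> h y = h x" by (simp only:)
  then show ?thesis using M.meet_right[OF c] by (simp only:)
qed

text \<open>The adjunction between \<open>r\<close> and the inclusion of \<open>S\<close>, written
  elementwise. Closure of \<open>S\<close> under joins stays out of the assumptions because for
  images of cones it is derived after the adjunction.\<close>

locale reflective_subset = frame L for L :: "'a gorder" (structure) +
  fixes S :: "'a set" and r :: "'a \<Rightarrow> 'a"
  assumes subset: "S \<subseteq> carrier L"
    and reflect_in: "x \<in> carrier L \<Longrightarrow> r x \<in> S"
    and reflect_le_iff: "\<lbrakk>x \<in> carrier L; y \<in> S\<rbrakk> \<Longrightarrow> r x \<sqsubseteq> y \<longleftrightarrow> x \<sqsubseteq> y"
begin

lemma reflect_closed [simp]: "x \<in> carrier L \<Longrightarrow> r x \<in> carrier L"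
  using subset reflect_in by auto

lemma le_reflect: "x \<in> carrier L \<Longrightarrow> x \<sqsubseteq> r x"
  using reflect_le_iff[of x "r x"] reflect_in by simp

lemma reflect_mono:
  assumes "x \<in> carrier L" "y \<in> carrier L" "x \<sqsubseteq> y"
  shows "r x \<sqsubseteq> r y"
  using assms reflect_le_iff[of x "r y"] reflect_in le_reflect[of y] le_trans[of x y "r y"] by auto

lemma reflect_fixed: "x \<in> S \<Longrightarrow> r x = x"
  using subset reflect_le_iff[of x x] le_reflect[of x] by (intro le_antisym) auto

lemma reflect_image: "r ` carrier L = S"
proof
  show "r ` carrier L \<subseteq> S" using reflect_in by blast
  show "S \<subseteq> r ` carrier L"
  proof
    fix y assume "y \<in> S"
    then show "y \<in> r ` carrier L" using reflect_fixed[of y] subset by (intro image_eqI[of y r y]) auto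
  qed
qed

text \<open>\<open>r x\<close> belongs to the set on the right and bounds it from below. The formula
  mentions only \<open>S\<close> and the order, so this is uniqueness of left adjoints.\<close>

lemma reflect_eq_Inf:
  assumes "x \<in> carrier L"
  shows "r x = \<Sqinter>{y \<in> S. x \<sqsubseteq> y}"
proof (rule le_antisym)
  show "r x \<sqsubseteq> \<Sqinter>{y \<in> S. x \<sqsubseteq> y}"
    using assms subset reflect_le_iff by (intro inf_greatest) auto
  show "\<Sqinter>{y \<in> S. x \<sqsubseteq> y} \<sqsubseteq> r x"
    using assms subset reflect_in le_reflect by (intro inf_lower) auto
qed (use assms subset in \<open>auto intro!: inf_closed\<close>)

text \<open>A left adjoint preserves joins as computed in \<open>S\<close>; the assumption
  \<open>joins\<close> makes these the joins of the ambient frame.\<close>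

lemma reflect_Sup:
  assumes "A \<subseteq> carrier L" and joins: "\<And>B. B \<subseteq> S \<Longrightarrow> \<Squnion>B \<in> S"
  shows "r (\<Squnion>A) = \<Squnion>(r ` A)"
proof (rule le_antisym)
  have rA: "r ` A \<subseteq> S" "r ` A \<subseteq> carrier L" using assms(1) reflect_in by auto
  have "\<Squnion>A \<sqsubseteq> \<Squnion>(r ` A)"
    using Sup_mono_family[of "\<lambda>x. x" A r] assms(1) rA(2) le_reflect by (simp add: subset_iff)
  then show "r (\<Squnion>A) \<sqsubseteq> \<Squnion>(r ` A)"
    using reflect_le_iff[of "\<Squnion>A" "\<Squnion>(r ` A)"] assms(1) joins[OF rA(1)] by simp
  show "\<Squnion>(r ` A) \<sqsubseteq> r (\<Squnion>A)"
  proof (rule sup_least[OF rA(2)])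
    show "r (\<Squnion>A) \<in> carrier L" using assms(1) by simp
    fix z assume "z \<in> r ` A"
    then obtain a where a: "a \<in> A" "z = r a" by auto
    then show "z \<sqsubseteq> r (\<Squnion>A)" using assms(1) sup_upper[of A a] reflect_mono[of a "\<Squnion>A"] by auto
  qed
  show "r (\<Squnion>A) \<in> carrier L" "\<Squnion>(r ` A) \<in> carrier L" using assms(1) rA by auto
qed

text \<open>An element lies in \<open>S\<close> as soon as \<open>r x \<sqsubseteq> x\<close>, and
  this condition passes to finite meets because the reflection of a meet stays below each factor in
  \<open>S\<close>.\<close>

lemma subframe_if_Sup_closed:
  assumes joins: "\<And>B. B \<subseteq> S \<Longrightarrow> \<Squnion>B \<in> S"
  shows "subframe S L"
proof -
  have in_S: "x \<in> S" if "x \<in> carrier L" "r x \<sqsubseteq> x" for x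
    using that le_antisym[of "r x" x] le_reflect reflect_in[of x] by auto
  have "x \<sqinter> y \<in> S" if "x \<in> S" "y \<in> S" for x y
  proof (rule in_S)
    have c: "x \<in> carrier L" "y \<in> carrier L" using that subset by auto
    then show m: "x \<sqinter> y \<in> carrier L" by simp
    have "r (x \<sqinter> y) \<sqsubseteq> x" "r (x \<sqinter> y) \<sqsubseteq> y"
      using that m c reflect_le_iff meet_left meet_right by auto
    then show "r (x \<sqinter> y) \<sqsubseteq> x \<sqinter> y" using c m by (intro meet_le) auto
  qed
  moreover have "\<top> \<in> S" by (rule in_S) (auto intro: top_higher)
  ultimately show ?thesis using subset joins by (auto simp: subframe_def)
qed

lemma inclusion_has_left_adjoint: "inclusion_has_left_adjoint S L"
proof -
  have LS: "partial_order (L\<lparr>carrier := S\<rparr>)"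
    using subset le_trans
    by unfold_locales (auto simp: eq_is_equal subset_eq)
  have "galois_connection \<lparr>orderA = L, orderB = L\<lparr>carrier := S\<rparr>, lower = r, upper = id\<rparr>"
    by (intro galois_connection.intro connection.intro galois_connection_axioms.intro)
      (use LS subset reflect_in reflect_le_iff partial_order_axioms in auto)
  then show ?thesis unfolding inclusion_has_left_adjoint_def by blast
qed

end

text \<open>\<open>reflective\<close> only asserts that adjoints exist, while the inverse
  construction needs adjoints determined by the triple itself. For a subframe whose inclusion has a
  left adjoint, this formula computes it.\<close>

definition reflection :: "'a gorder \<Rightarrow> 'a set \<Rightarrow> 'a \<Rightarrow> 'a" where
  "reflection L S x = \<Sqinter>\<^bsub>L\<^esub>{y \<in> S. x \<sqsubseteq>\<^bsub>L\<^esub> y}"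

lemma (in reflective_subset) reflection_eq: "x \<in> carrier L \<Longrightarrow> reflection L S x = r x"
  by (simp add: reflection_def reflect_eq_Inf)

lemma reflective_subset_reflection:
  assumes "frame L" "subframe S L" "inclusion_has_left_adjoint S L"
  shows "reflective_subset L S (reflection L S)"
proof -
  obtain l where g: "galois_connection \<lparr>orderA = L, orderB = L\<lparr>carrier := S\<rparr>, lower = l, upper = id\<rparr>"
    using assms(3) by (auto simp: inclusion_has_left_adjoint_def)
  interpret frame L by fact
  \<comment> \<open>Any adjoint \<open>l\<close> from the existential is a reflector, so it agrees
    with \<open>reflection L S\<close> on the carrier; \<open>reflective_subset\<close> evaluates
    the reflector nowhere else.\<close>
  interpret l: reflective_subset L S l
  proof
    show "S \<subseteq> carrier L" using assms(2) by (simp add: subframe_def)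
    show "l x \<in> S" if "x \<in> carrier L" for x
      using that galois_connection.axioms(1)[OF g, THEN connection.lower_closed] by simp
    show "l x \<sqsubseteq>\<^bsub>L\<^esub> y \<longleftrightarrow> x \<sqsubseteq>\<^bsub>L\<^esub> y" if "x \<in> carrier L" "y \<in> S" for x y
      using that galois_connection.galois_property[OF g] by simp
  qed
  show ?thesis
    by unfold_locales
      (use l.subset l.reflect_in l.reflect_le_iff in \<open>auto simp: l.reflection_eq\<close>)
qed

section \<open>From ordered locales to reflective biframes\<close>

text \<open>Reversing the preorder swaps the cones, so facts about lower cones can be read off from
  those about upper cones for \<open>T\<inverse>\<close>.\<close>

lemma down_cone_converse: "down_cone (L, T) = up_cone (L, T\<inverse>)"
  by (simp add: up_cone_def down_cone_def fun_eq_iff)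

lemma im_down_converse: "im_down (L, T) = im_up (L, T\<inverse>)"
  by (simp add: im_up_def im_down_def down_cone_converse)

section \<open>Cones of an ordered locale as closure operators\<close>

lemma ordered_localeD:
  assumes "ordered_locale (L, T)"
  shows "frame L" "T \<subseteq> carrier L \<times> carrier L" "refl_on (carrier L) T" "trans T"
    and "S \<subseteq> T \<Longrightarrow> (\<Squnion>\<^bsub>L\<^esub>(fst ` S), \<Squnion>\<^bsub>L\<^esub>(snd ` S)) \<in> T"
  using assms by (simp_all add: ordered_locale_def preorder_on_def)

lemma ordered_locale_converse:
  assumes "ordered_locale (L, T)"
  shows "ordered_locale (L, T\<inverse>)"
proof -
  note D = ordered_localeD[OF assms]
  have "(\<Squnion>\<^bsub>L\<^esub>(fst ` S), \<Squnion>\<^bsub>L\<^esub>(snd ` S)) \<in> T\<inverse>" if "S \<subseteq> T\<inverse>" for S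
  proof -
    have "S\<inverse> \<subseteq> T" "fst ` S\<inverse> = snd ` S" "snd ` S\<inverse> = fst ` S" using that by force+
    then show ?thesis using D(5)[of "S\<inverse>"] by simp
  qed
  moreover have "preorder_on (carrier L) (T\<inverse>)"
    using D(2-4) by (auto simp: preorder_on_def refl_on_def)
  ultimately show ?thesis using D(1) by (simp add: ordered_locale_def)
qed

text \<open>The join defining the cone is attained: the join axiom is applied to all pairs in
  \<open>T\<close> with first component \<open>U\<close>.\<close>

lemma up_cone_related:
  assumes "ordered_locale (L, T)" "U \<in> carrier L"
  shows "(U, up_cone (L, T) U) \<in> T"
proof -
  interpret frame L using assms(1) by (rule ordered_localeD)
  let ?S = "Pair U ` {V. (U, V) \<in> T}"
  \<comment> \<open>Reflexivity makes the family nonempty; for an empty one the first components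
    would join to the bottom element instead of \<open>U\<close>.\<close>
  have "(U, U) \<in> T" using ordered_localeD(3)[OF assms(1)] assms(2) by (simp add: refl_on_def)
  then have "fst ` ?S = {U}" by (auto simp: image_image image_constant_conv)
  moreover have "snd ` ?S = {V. (U, V) \<in> T}" by (simp add: image_image)
  moreover have "(\<Squnion>\<^bsub>L\<^esub>(fst ` ?S), \<Squnion>\<^bsub>L\<^esub>(snd ` ?S)) \<in> T"
    by (rule ordered_localeD(5)[OF assms(1)]) auto
  ultimately show ?thesis using assms(2) by (simp add: up_cone_def)
qed

lemma le_up_cone:
  assumes "ordered_locale (L, T)" "(U, V) \<in> T"
  shows "V \<sqsubseteq>\<^bsub>L\<^esub> up_cone (L, T) U"
proof -
  interpret frame L using assms(1) by (rule ordered_localeD)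
  have "T \<subseteq> carrier L \<times> carrier L" using assms(1) by (rule ordered_localeD)
  then show ?thesis using assms(2) by (auto simp: up_cone_def intro!: sup_upper)
qed

text \<open>Each closure law has its own source: reflexivity of \<open>T\<close> for increasing,
  transitivity for idempotent, join preservation for monotone. A closure operator reflects onto its
  fixed points.\<close>

lemma up_cone_reflective:
  assumes oL: "ordered_locale (L, T)"
    and joins: "\<And>A. A \<subseteq> carrier L \<Longrightarrow>
      up_cone (L, T) (\<Squnion>\<^bsub>L\<^esub>A) = \<Squnion>\<^bsub>L\<^esub>(up_cone (L, T) ` A)"
  shows "reflective_subset L (im_up (L, T)) (up_cone (L, T))" (is ?refl)
    and "subframe (im_up (L, T)) L"
proof -
  let ?u = "up_cone (L, T)"
  interpret frame L using oL by (rule ordered_localeD)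
  have T: "T \<subseteq> carrier L \<times> carrier L" "refl_on (carrier L) T" "trans T"
    using ordered_localeD[OF oL] by simp_all
  have closed: "?u U \<in> carrier L" if "U \<in> carrier L" for U
    using up_cone_related[OF oL that] T(1) by auto
  have increasing: "U \<sqsubseteq>\<^bsub>L\<^esub> ?u U" if "U \<in> carrier L" for U
    using le_up_cone[OF oL] T(2) that by (simp add: refl_on_def)
  have idem: "?u (?u U) = ?u U" if "U \<in> carrier L" for U
  proof (rule le_antisym)
    show "?u (?u U) \<sqsubseteq>\<^bsub>L\<^esub> ?u U"
      using le_up_cone[OF oL] up_cone_related[OF oL] T(3) that closed by (meson transD)
  qed (use that closed increasing in auto)
  \<comment> \<open>Monotonicity is preservation of binary joins, since
    \<open>U \<sqsubseteq> V\<close> says that the join of \<open>{U, V}\<close> is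
    \<open>V\<close>.\<close>
  have mono: "?u U \<sqsubseteq>\<^bsub>L\<^esub> ?u V" if UV: "U \<in> carrier L" "V \<in> carrier L" "U \<sqsubseteq>\<^bsub>L\<^esub> V" for U V
  proof -
    have "\<Squnion>\<^bsub>L\<^esub>{U, V} = V"
      using UV by (intro le_antisym sup_least sup_upper) auto
    then have "?u V = \<Squnion>\<^bsub>L\<^esub>{?u U, ?u V}"
      using joins[of "{U, V}"] UV by simp
    then show ?thesis using closed UV sup_upper[of "{?u U, ?u V}" "?u U"] by simp
  qed
  show ?refl
  proof
    show "im_up (L, T) \<subseteq> carrier L" using closed by (auto simp: im_up_def)
    show "?u x \<in> im_up (L, T)" if "x \<in> carrier L" for x using that by (simp add: im_up_def)
    fix x y assume x: "x \<in> carrier L" and y: "y \<in> im_up (L, T)"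
    then have y': "y \<in> carrier L" "?u y = y" using closed idem by (auto simp: im_up_def)
    show "?u x \<sqsubseteq>\<^bsub>L\<^esub> y \<longleftrightarrow> x \<sqsubseteq>\<^bsub>L\<^esub> y"
      using mono[of x y] x y' increasing[of x] closed[of x] le_trans[of x "?u x" y] by auto
  qed
  then interpret r: reflective_subset L "im_up (L, T)" ?u .
  show "subframe (im_up (L, T)) L"
  proof (rule r.subframe_if_Sup_closed)
    fix B assume B: "B \<subseteq> im_up (L, T)"
    \<comment> \<open>Members of \<open>B\<close> are fixed by the cone, so join preservation fixes
      their join.\<close>
    then have "?u (\<Squnion>\<^bsub>L\<^esub>B) = \<Squnion>\<^bsub>L\<^esub>B"
      using joins[of B] r.subset r.reflect_fixed by (simp add: subset_iff cong: image_cong_simp)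
    moreover have "\<Squnion>\<^bsub>L\<^esub>B \<in> carrier L" using B r.subset by auto
    ultimately show "\<Squnion>\<^bsub>L\<^esub>B \<in> im_up (L, T)" using r.reflect_in by metis
  qed
qed

lemma down_cone_reflective:
  assumes "ordered_locale (L, T)"
    and "\<And>A. A \<subseteq> carrier L \<Longrightarrow>
      down_cone (L, T) (\<Squnion>\<^bsub>L\<^esub>A) = \<Squnion>\<^bsub>L\<^esub>(down_cone (L, T) ` A)"
  shows "reflective_subset L (im_down (L, T)) (down_cone (L, T))"
    and "subframe (im_down (L, T)) L"
  using up_cone_reflective[OF ordered_locale_converse[OF assms(1)]] assms(2)
  by (simp_all add: down_cone_converse im_down_converse)

section \<open>The biframe of an ordered locale\<close>

abbreviation (input) good_ordered_locale :: "'a ordered_loc \<Rightarrow> bool" where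
  "good_ordered_locale X \<equiv> ordered_locale X \<and> convex_ordered X \<and> C_order X \<and> C_join X"

abbreviation (input) biframe_of :: "'a ordered_loc \<Rightarrow> 'a biframe_triple" where
  "biframe_of X \<equiv> (fst X, im_up X, im_down X)"

lemma cones_reflective:
  assumes "ordered_locale (L, T)" "C_join (L, T)"
  shows "reflective_subset L (im_up (L, T)) (up_cone (L, T))"
    and "reflective_subset L (im_down (L, T)) (down_cone (L, T))"
    and "subframe (im_up (L, T)) L" "subframe (im_down (L, T)) L"
  using up_cone_reflective[OF assms(1)] down_cone_reflective[OF assms(1)] assms(2)
  by (auto simp: C_join_def)

lemma biframe_of_reflective:
  assumes "good_ordered_locale X"
  shows "biframe (biframe_of X)" "reflective (biframe_of X)"
proof -
  obtain L T where X: "X = (L, T)" by (cases X)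
  note oL = assms[unfolded X]
  note c = cones_reflective[of L T]
  \<comment> \<open>Convexity indexes its generators by \<open>V\<close> and \<open>W\<close>, the
    biframe axiom by members of the two images; the sets of meets coincide.\<close>
  have "{up_cone (L, T) V \<sqinter>\<^bsub>L\<^esub> down_cone (L, T) W | V W. V \<in> carrier L \<and> W \<in> carrier L}
      = {y \<sqinter>\<^bsub>L\<^esub> z | y z. y \<in> im_up (L, T) \<and> z \<in> im_down (L, T)}"
    by (auto simp: im_up_def im_down_def)
  then show "biframe (biframe_of X)"
    using oL c(3,4) by (simp add: X biframe_def convex_ordered_def ordered_locale_def)
  show "reflective (biframe_of X)"
    using oL c(1,2)[THEN reflective_subset.inclusion_has_left_adjoint]
    by (simp add: X reflective_def)
qed

section \<open>From reflective biframes to ordered locales\<close>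

text \<open>The right-hand side of (C-\<unlhd>) turned into a definition, with the reflections onto
  \<open>L1\<close> and \<open>L2\<close> standing in for the upper and lower cones.\<close>

definition biframe_order :: "'a biframe_triple \<Rightarrow> 'a rel" where
  "biframe_order = (\<lambda>(L, L1, L2). {(U, V). U \<in> carrier L \<and> V \<in> carrier L \<and>
     U \<sqsubseteq>\<^bsub>L\<^esub> reflection L L2 V \<and> V \<sqsubseteq>\<^bsub>L\<^esub> reflection L L1 U})"

definition ordered_locale_of :: "'a biframe_triple \<Rightarrow> 'a ordered_loc" where
  "ordered_locale_of B = (fst B, biframe_order B)"

lemma biframe_order_converse: "(biframe_order (L, L1, L2))\<inverse> = biframe_order (L, L2, L1)"
  by (auto simp: biframe_order_def)

text \<open>The last conjunct of the order bounds every \<open>V\<close> in the join by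
  \<open>reflection L L1 U\<close>, to which \<open>U\<close> is itself related, so the join is a
  maximum.\<close>

lemma up_cone_biframe_order:
  assumes "reflective_subset L L1 (reflection L L1)" "reflective_subset L L2 (reflection L L2)"
    and U: "U \<in> carrier L"
  shows "up_cone (L, biframe_order (L, L1, L2)) U = reflection L L1 U"
proof -
  interpret u: reflective_subset L L1 "reflection L L1" by fact
  interpret d: reflective_subset L L2 "reflection L L2" by fact
  \<comment> \<open>The half of that relation concerning \<open>L2\<close>: both reflections are
    increasing, so \<open>U\<close> lies below its reflection onto \<open>L1\<close>, which lies
    below its own reflection onto \<open>L2\<close>.\<close>
  have "U \<sqsubseteq>\<^bsub>L\<^esub> reflection L L2 (reflection L L1 U)"
    using U u.le_reflect[of U] d.le_reflect[of "reflection L L1 U"]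
      u.le_trans[of U "reflection L L1 U" "reflection L L2 (reflection L L1 U)"] by simp
  then have "(U, reflection L L1 U) \<in> biframe_order (L, L1, L2)"
    using U by (simp add: biframe_order_def)
  then show ?thesis
    unfolding up_cone_def prod.case using U
    by (intro u.le_antisym u.sup_upper u.sup_least u.sup_closed)
      (auto simp: biframe_order_def)
qed

lemma down_cone_biframe_order:
  assumes "reflective_subset L L1 (reflection L L1)" "reflective_subset L L2 (reflection L L2)"
    and "U \<in> carrier L"
  shows "down_cone (L, biframe_order (L, L1, L2)) U = reflection L L2 U"
  using up_cone_biframe_order[OF assms(2,1,3)]
  by (simp add: down_cone_converse biframe_order_converse)

lemma trans_biframe_order:
  assumes "reflective_subset L L1 (reflection L L1)" "reflective_subset L L2 (reflection L L2)"
  shows "trans (biframe_order (L, L1, L2))"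
proof -
  \<comment> \<open>Each half of the order composes on its own: as \<open>reflection L S z\<close>
    lies in \<open>S\<close>, \<open>y \<sqsubseteq> reflection L S z\<close> lifts to
    \<open>reflection L S y \<sqsubseteq> reflection L S z\<close>.\<close>
  have step: "x \<sqsubseteq>\<^bsub>L\<^esub> reflection L S z"
    if "reflective_subset L S (reflection L S)" "x \<in> carrier L" "y \<in> carrier L" "z \<in> carrier L"
      "x \<sqsubseteq>\<^bsub>L\<^esub> reflection L S y" "y \<sqsubseteq>\<^bsub>L\<^esub> reflection L S z" for S x y z
  proof -
    interpret reflective_subset L S "reflection L S" by fact
    show ?thesis
      using that reflect_le_iff[of y "reflection L S z"] reflect_in[of z]
        le_trans[of x "reflection L S y" "reflection L S z"] by simp
  qed
  show ?thesis
    by (rule transI) (auto simp: biframe_order_def intro: step[OF assms(1)] step[OF assms(2)])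
qed

text \<open>Serves the join axiom of the induced preorder, whose two halves are instances for the
  two reflections with the roles of \<open>f\<close> and \<open>g\<close> exchanged.\<close>

lemma (in reflective_subset) Sup_le_reflect_Sup:
  assumes "f ` I \<subseteq> carrier L" "g ` I \<subseteq> carrier L" "\<And>i. i \<in> I \<Longrightarrow> f i \<sqsubseteq> r (g i)"
  shows "\<Squnion>(f ` I) \<sqsubseteq> r (\<Squnion>(g ` I))"
proof (rule sup_least[OF assms(1)])
  show c: "r (\<Squnion>(g ` I)) \<in> carrier L" using assms(2) by simp
  fix z assume "z \<in> f ` I"
  then obtain i where i: "i \<in> I" "z = f i" by auto
  have "r (g i) \<sqsubseteq> r (\<Squnion>(g ` I))"
    using i assms(2) by (intro reflect_mono sup_upper) auto
  then show "z \<sqsubseteq> r (\<Squnion>(g ` I))"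
    using i assms c le_trans[of "f i" "r (g i)" "r (\<Squnion>(g ` I))"] by (auto simp: image_subset_iff)
qed

section \<open>The two round trips on objects\<close>

lemma reflective_biframe_reflections:
  assumes "biframe (L, L1, L2)" "reflective (L, L1, L2)"
  shows "reflective_subset L L1 (reflection L L1)" "reflective_subset L L2 (reflection L L2)"
  using assms reflective_subset_reflection by (auto simp: biframe_def reflective_def)

text \<open>The cones of the induced order are the reflections, and a reflector is onto its subset,
  so taking images recovers \<open>L1\<close> and \<open>L2\<close>.\<close>

lemma biframe_of_ordered_locale_of:
  assumes "biframe B" "reflective B"
  shows "biframe_of (ordered_locale_of B) = B"
proof -
  obtain L L1 L2 where B: "B = (L, L1, L2)" by (cases B)
  note r = reflective_biframe_reflections[OF assms[unfolded B]]
  have "up_cone (L, biframe_order (L, L1, L2)) ` carrier L = reflection L L1 ` carrier L"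
    "down_cone (L, biframe_order (L, L1, L2)) ` carrier L = reflection L L2 ` carrier L"
    by (auto intro!: image_cong up_cone_biframe_order[OF r] down_cone_biframe_order[OF r])
  then show ?thesis
    using r[THEN reflective_subset.reflect_image]
    by (simp add: B ordered_locale_of_def im_up_def im_down_def)
qed

lemma good_ordered_locale_of:
  assumes "biframe B" "reflective B"
  shows "good_ordered_locale (ordered_locale_of B)"
proof -
  obtain L L1 L2 where B: "B = (L, L1, L2)" by (cases B)
  note r = reflective_biframe_reflections[OF assms[unfolded B]]
  let ?T = "biframe_order (L, L1, L2)"
  interpret u: reflective_subset L L1 "reflection L L1" by fact
  interpret d: reflective_subset L L2 "reflection L L2" by fact
  note cones = up_cone_biframe_order[OF r] down_cone_biframe_order[OF r]
  have T: "?T \<subseteq> carrier L \<times> carrier L" by (auto simp: biframe_order_def)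
  have "(\<Squnion>\<^bsub>L\<^esub>(fst ` S), \<Squnion>\<^bsub>L\<^esub>(snd ` S)) \<in> ?T" if S: "S \<subseteq> ?T" for S
  proof -
    have c: "fst ` S \<subseteq> carrier L" "snd ` S \<subseteq> carrier L" using S T by auto
    have "\<And>p. p \<in> S \<Longrightarrow> fst p \<sqsubseteq>\<^bsub>L\<^esub> reflection L L2 (snd p)"
      "\<And>p. p \<in> S \<Longrightarrow> snd p \<sqsubseteq>\<^bsub>L\<^esub> reflection L L1 (fst p)"
      using S by (auto simp: biframe_order_def)
    then show ?thesis
      using c d.Sup_le_reflect_Sup[OF c] u.Sup_le_reflect_Sup[OF c(2,1)]
      by (simp add: biframe_order_def)
  qed
  moreover have "refl_on (carrier L) ?T"
    by (auto simp: refl_on_def biframe_order_def u.le_reflect d.le_reflect)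
  ultimately have ol: "ordered_locale (L, ?T)"
    using trans_biframe_order[OF r] T u.frame_axioms by (auto simp: ordered_locale_def preorder_on_def)
  have co: "C_order (L, ?T)"
    unfolding C_order_def prod.case
  proof (intro ballI)
    fix U V assume UV: "U \<in> carrier L" "V \<in> carrier L"
    show "(U, V) \<in> ?T \<longleftrightarrow> U \<sqsubseteq>\<^bsub>L\<^esub> down_cone (L, ?T) V \<and> V \<sqsubseteq>\<^bsub>L\<^esub> up_cone (L, ?T) U"
      unfolding cones(1)[OF UV(1)] cones(2)[OF UV(2)] using UV by (simp add: biframe_order_def)
  qed
  \<comment> \<open>Because \<open>L1\<close> and \<open>L2\<close> are subframes, the reflections
    preserve joins taken in \<open>L\<close>, which yields (C-\<or>).\<close>
  have joins: "\<And>A. A \<subseteq> L1 \<Longrightarrow> \<Squnion>\<^bsub>L\<^esub>A \<in> L1" "\<And>A. A \<subseteq> L2 \<Longrightarrow> \<Squnion>\<^bsub>L\<^esub>A \<in> L2"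
    using assms(1) by (auto simp: B biframe_def subframe_def)
  have "C_join (L, ?T)"
    unfolding C_join_def prod.case
  proof (intro allI impI)
    fix A assume A: "A \<subseteq> carrier L"
    then have "up_cone (L, ?T) ` A = reflection L L1 ` A" "down_cone (L, ?T) ` A = reflection L L2 ` A"
      using cones by (auto intro!: image_cong)
    then show "up_cone (L, ?T) (\<Squnion>\<^bsub>L\<^esub>A) = \<Squnion>\<^bsub>L\<^esub>(up_cone (L, ?T) ` A) \<and>
       down_cone (L, ?T) (\<Squnion>\<^bsub>L\<^esub>A) = \<Squnion>\<^bsub>L\<^esub>(down_cone (L, ?T) ` A)"
      using A cones u.reflect_Sup[OF A joins(1)] d.reflect_Sup[OF A joins(2)] by simp
  qed
  moreover have "convex_ordered (L, ?T)"
  proof -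
    have "{up_cone (L, ?T) V \<sqinter>\<^bsub>L\<^esub> down_cone (L, ?T) W | V W. V \<in> carrier L \<and> W \<in> carrier L}
      = {y \<sqinter>\<^bsub>L\<^esub> z | y z. y \<in> im_up (L, ?T) \<and> z \<in> im_down (L, ?T)}"
      by (auto simp: im_up_def im_down_def)
    \<comment> \<open>The round trip identifies the images of the cones with \<open>L1\<close> and
      \<open>L2\<close>, so convexity becomes the generation axiom of the biframe.\<close>
    then show ?thesis
      using assms(1) biframe_of_ordered_locale_of[OF assms]
      by (simp add: B convex_ordered_def biframe_def ordered_locale_of_def)
  qed
  ultimately show ?thesis using ol co by (simp add: B ordered_locale_of_def)
qed

lemma ordered_locale_of_biframe_of:
  assumes "good_ordered_locale X"
  shows "ordered_locale_of (biframe_of X) = X"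
proof -
  obtain L T where X: "X = (L, T)" by (cases X)
  interpret u: reflective_subset L "im_up (L, T)" "up_cone (L, T)"
    using cones_reflective assms X by blast
  interpret d: reflective_subset L "im_down (L, T)" "down_cone (L, T)"
    using cones_reflective assms X by blast
  have T: "T \<subseteq> carrier L \<times> carrier L"
    using assms by (simp add: X ordered_localeD)
  \<comment> \<open>By uniqueness of adjoints the reflections onto the images are the original
    cones; (C-\<unlhd>) then identifies the resulting set with \<open>T\<close>.\<close>
  have "biframe_order (L, im_up (L, T), im_down (L, T)) =
      {(U, V). U \<in> carrier L \<and> V \<in> carrier L \<and>
        U \<sqsubseteq>\<^bsub>L\<^esub> down_cone (L, T) V \<and> V \<sqsubseteq>\<^bsub>L\<^esub> up_cone (L, T) U}"
    by (auto simp: biframe_order_def u.reflection_eq d.reflection_eq)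
  also have "\<dots> = T"
    using assms T by (auto simp: X C_order_def)
  finally show ?thesis by (simp add: X ordered_locale_of_def)
qed

section \<open>Morphisms\<close>

text \<open>Only the upper half is treated, since the lower half is the same statement for the
  converse preorders. Here \<open>h\<close> runs from the opens of the codomain \<open>M\<close> to
  those of the domain \<open>L\<close>.\<close>

lemma upper_monotone_iff:
  assumes L: "ordered_locale (L, T)" "reflective_subset L (im_up (L, T)) (up_cone (L, T))"
    and M: "ordered_locale (M, R)" "reflective_subset M (im_up (M, R)) (up_cone (M, R))"
    and h: "h \<in> frame_homs M L"
  shows "(\<forall>U U' V. (U, U') \<in> T \<and> V \<in> carrier M \<and> U \<sqsubseteq>\<^bsub>L\<^esub> h V \<longrightarrow>
      (\<exists>V'. (V, V') \<in> R \<and> U' \<sqsubseteq>\<^bsub>L\<^esub> h V')) \<longleftrightarrow> h ` im_up (M, R) \<subseteq> im_up (L, T)"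
    (is "?mono \<longleftrightarrow> ?image")
proof -
  interpret L: reflective_subset L "im_up (L, T)" "up_cone (L, T)" by fact
  interpret M: reflective_subset M "im_up (M, R)" "up_cone (M, R)" by fact
  have T: "T \<subseteq> carrier L \<times> carrier L" and R: "R \<subseteq> carrier M \<times> carrier M"
    using L(1) M(1) by (simp_all add: ordered_localeD)
  have hc: "h x \<in> carrier L" if "x \<in> carrier M" for x
    using h that by (auto simp: frame_homs_def)
  note hm = frame_homs_mono[OF M.frame_axioms L.frame_axioms h]
  show ?thesis
  proof
    assume mono: ?mono
    show ?image
    proof safe
      fix y assume y: "y \<in> im_up (M, R)"
      then have yc: "y \<in> carrier M" using M.subset by auto
      \<comment> \<open>The condition is tested in the extreme case \<open>U = h y\<close>,
        \<open>U' = up_cone (L, T) (h y)\<close>, \<open>V = y\<close>.\<close>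
      have "(h y, up_cone (L, T) (h y)) \<in> T" using up_cone_related[OF L(1)] yc hc by simp
      then obtain V' where V': "(y, V') \<in> R" "up_cone (L, T) (h y) \<sqsubseteq>\<^bsub>L\<^esub> h V'"
        using mono[rule_format, of "h y" "up_cone (L, T) (h y)" y] yc hc by auto
      have V'c: "V' \<in> carrier M" using V'(1) R by auto
      \<comment> \<open>As \<open>y\<close> is its own upper cone, every \<open>V'\<close> with
        \<open>(y, V')\<close> in \<open>R\<close> is below \<open>y\<close>; this forces the cone
        of \<open>h y\<close> below \<open>h y\<close>.\<close>
      have "V' \<sqsubseteq>\<^bsub>M\<^esub> y" using le_up_cone[OF M(1) V'(1)] M.reflect_fixed[OF y] by simp
      then have "h V' \<sqsubseteq>\<^bsub>L\<^esub> h y" using hm V'c yc by simp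
      then have "up_cone (L, T) (h y) \<sqsubseteq>\<^bsub>L\<^esub> h y"
        using V'(2) L.le_trans[of "up_cone (L, T) (h y)" "h V'" "h y"] hc V'c yc by simp
      then have "up_cone (L, T) (h y) = h y"
        using L.le_reflect hc yc by (intro L.le_antisym) auto
      then show "h y \<in> im_up (L, T)" using L.reflect_in[of "h y"] hc yc by simp
    qed
  next
    assume image: ?image
    show ?mono
    proof (intro allI impI, elim conjE)
      fix U U' V assume UU': "(U, U') \<in> T" and V: "V \<in> carrier M" and UV: "U \<sqsubseteq>\<^bsub>L\<^esub> h V"
      \<comment> \<open>The largest possible witness: \<open>h ?V'\<close> is a fixed point of the
        cone on \<open>L\<close> above \<open>U\<close>, hence above the whole cone of
        \<open>U\<close> and so above \<open>U'\<close>.\<close>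
      let ?V' = "up_cone (M, R) V"
      have c: "U \<in> carrier L" "U' \<in> carrier L" "?V' \<in> carrier M" "h V \<in> carrier L" "h ?V' \<in> carrier L"
        using UU' T V hc by auto
      have "h ?V' \<in> im_up (L, T)" using image M.reflect_in[OF V] by auto
      moreover have "U \<sqsubseteq>\<^bsub>L\<^esub> h ?V'"
        using hm[of V ?V'] V c M.le_reflect UV L.le_trans[of U "h V" "h ?V'"] by simp
      ultimately have "up_cone (L, T) U \<sqsubseteq>\<^bsub>L\<^esub> h ?V'" using L.reflect_le_iff c by simp
      then have "U' \<sqsubseteq>\<^bsub>L\<^esub> h ?V'"
        using le_up_cone[OF L(1) UU'] c L.le_trans[of U' "up_cone (L, T) U" "h ?V'"] by simp
      then show "\<exists>V'. (V, V') \<in> R \<and> U' \<sqsubseteq>\<^bsub>L\<^esub> h V'" using up_cone_related[OF M(1) V] by blast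
    qed
  qed
qed

lemma monotone_map_iff:
  assumes X: "good_ordered_locale X" and Y: "good_ordered_locale Y"
    and h: "h \<in> frame_homs (fst Y) (fst X)"
  shows "monotone_map X Y h \<longleftrightarrow> h ` im_up Y \<subseteq> im_up X \<and> h ` im_down Y \<subseteq> im_down X"
proof -
  obtain L T where LT: "X = (L, T)" by (cases X)
  obtain M R where MR: "Y = (M, R)" by (cases Y)
  have L: "ordered_locale (L, T)" "C_join (L, T)" using X LT by simp_all
  have M: "ordered_locale (M, R)" "C_join (M, R)" using Y MR by simp_all
  have h': "h \<in> frame_homs M L" using h LT MR by simp
  note up = upper_monotone_iff[OF L(1) cones_reflective(1)[OF L] M(1) cones_reflective(1)[OF M] h']
  \<comment> \<open>Unfolding turns lower cones into upper cones of the converses, so the same lemma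
    delivers the lower condition.\<close>
  note down = upper_monotone_iff[OF ordered_locale_converse[OF L(1)]
      cones_reflective(2)[OF L, unfolded im_down_converse down_cone_converse]
      ordered_locale_converse[OF M(1)]
      cones_reflective(2)[OF M, unfolded im_down_converse down_cone_converse] h']
  show ?thesis
    unfolding monotone_map_def inverse_image_def LT MR prod.case im_down_converse
      up[symmetric] down[symmetric] converse_iff
    by blast
qed

text \<open>A map of locales is represented by its frame homomorphism, so the hom-sets are equal as
  sets and \<open>op_cat\<close> accounts for the reversed direction.\<close>

lemma Hom_biframe_of:
  assumes "X \<in> Ob convex_ordered_locale_cat" "Y \<in> Ob convex_ordered_locale_cat"
  shows "Hom convex_ordered_locale_cat X Y =
    Hom (op_cat reflective_biframe_cat) (biframe_of X) (biframe_of Y)"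
  using assms monotone_map_iff[of X Y]
  by (simp add: convex_ordered_locale_cat_def reflective_biframe_cat_def op_cat_def
      biframe_maps_def locale_maps_def cong: conj_cong)

section \<open>The isomorphism of categories\<close>

lemma category_op_cat:
  assumes "category C"
  shows "category (op_cat C)"
proof -
  interpret category C by fact
  show ?thesis
    by unfold_locales
      (simp_all add: op_cat_def Ident_in_Hom Comp_in_Hom Comp_Ident_left Comp_Ident_right Comp_assoc)
qed

lemma frame_homs_id:
  assumes "frame L"
  shows "(\<lambda>x\<in>carrier L. x) \<in> frame_homs L L"
proof -
  interpret frame L by fact
  have "(\<lambda>x\<in>carrier L. x) ` A = A" if "A \<subseteq> carrier L" for A using that by force
  then show ?thesis by (auto simp: frame_homs_def)
qed

lemma frame_homs_compose:
  assumes "frame L" "g \<in> frame_homs M N" "f \<in> frame_homs L M"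
  shows "compose (carrier L) g f \<in> frame_homs L N"
proof -
  interpret frame L by fact
  have f: "f \<in> carrier L \<rightarrow> carrier M" and g: "g \<in> carrier M \<rightarrow> carrier N"
    using assms by (auto simp: frame_homs_def)
  have "compose (carrier L) g f ` A = g ` f ` A" "f ` A \<subseteq> carrier M" if "A \<subseteq> carrier L" for A
    using that f by (force simp: compose_def)+
  moreover have "compose (carrier L) g f \<in> carrier L \<rightarrow>\<^sub>E carrier N"
    using f g by (auto simp: compose_def)
  ultimately show ?thesis
    using assms(2,3) f by (auto simp: frame_homs_def compose_eq Pi_iff)
qed

lemma biframe_maps_iff:
  "h \<in> biframe_maps A B \<longleftrightarrow> h \<in> frame_homs (fst A) (fst B) \<and>
    h ` fst (snd A) \<subseteq> fst (snd B) \<and> h ` snd (snd A) \<subseteq> snd (snd B)"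
  by (cases A, cases B) (simp add: biframe_maps_def)

lemma category_reflective_biframe_cat: "category reflective_biframe_cat"
proof
  fix A B C D :: "'a biframe_triple" and f g h
  let ?C = "reflective_biframe_cat"
  have Ob_frame: "frame (fst X) \<and> fst (snd X) \<subseteq> carrier (fst X) \<and> snd (snd X) \<subseteq> carrier (fst X)"
    if "X \<in> Ob ?C" for X :: "'a biframe_triple"
    using that by (auto simp: reflective_biframe_cat_def biframe_def subframe_def)
  \<comment> \<open>Extensionality matters for the unit laws: \<open>compose\<close> yields
    \<open>undefined\<close> off the carrier, so \<open>f\<close> must do the same to be
    recovered.\<close>
  have Hom_ext: "f \<in> extensional (carrier (fst X)) \<and> f \<in> carrier (fst X) \<rightarrow> carrier (fst Y)"
    if "f \<in> Hom ?C X Y" for X Y :: "'a biframe_triple" and f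
    using that by (simp add: reflective_biframe_cat_def biframe_maps_iff frame_homs_def PiE_def)
  assume A: "A \<in> Ob ?C"
  show "Ident ?C A \<in> Hom ?C A A"
    using Ob_frame[OF A] frame_homs_id[of "fst A"]
    by (auto simp: reflective_biframe_cat_def biframe_maps_iff)
  assume B: "B \<in> Ob ?C" and f: "f \<in> Hom ?C A B"
  show "Comp ?C A A B f (Ident ?C A) = f" "Comp ?C A B B (Ident ?C B) f = f"
    using Hom_ext[OF f]
    by (auto simp: reflective_biframe_cat_def compose_def extensional_def fun_eq_iff)
  assume C: "C \<in> Ob ?C" and g: "g \<in> Hom ?C B C"
  have "compose (carrier (fst A)) g f \<in> frame_homs (fst A) (fst C)"
    using f g Ob_frame[OF A]
    by (intro frame_homs_compose[of _ _ "fst B"]) (auto simp: reflective_biframe_cat_def biframe_maps_iff)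
  then show "Comp ?C A B C g f \<in> Hom ?C A C"
    using f g Ob_frame[OF A]
    by (auto simp: reflective_biframe_cat_def biframe_maps_iff compose_eq subset_iff image_subset_iff)
  assume "D \<in> Ob ?C" and h: "h \<in> Hom ?C C D"
  show "Comp ?C A C D h (Comp ?C A B C g f) = Comp ?C A B D (Comp ?C B C D h g) f"
    using Hom_ext[OF f] by (auto simp: reflective_biframe_cat_def compose_def fun_eq_iff)
qed

text \<open>Both functors leave arrows unchanged, so every law reduces to one of \<open>D\<close>
  along the bijection of objects, including the category axioms of \<open>C\<close> itself.\<close>

lemma cat_isomorphism_if_Homs_equal:
  assumes "category D"
    and Fo: "\<And>X. X \<in> Ob C \<Longrightarrow> Fo X \<in> Ob D" and Go: "\<And>X. X \<in> Ob D \<Longrightarrow> Go X \<in> Ob C"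
    and GF: "\<And>X. X \<in> Ob C \<Longrightarrow> Go (Fo X) = X" and FG: "\<And>X. X \<in> Ob D \<Longrightarrow> Fo (Go X) = X"
    and Hom: "\<And>X Y. X \<in> Ob C \<Longrightarrow> Y \<in> Ob C \<Longrightarrow> Hom C X Y = Hom D (Fo X) (Fo Y)"
    and Ident: "\<And>X. X \<in> Ob C \<Longrightarrow> Ident C X = Ident D (Fo X)"
    and Comp: "\<And>X Y Z. X \<in> Ob C \<Longrightarrow> Y \<in> Ob C \<Longrightarrow> Z \<in> Ob C \<Longrightarrow>
      Comp C X Y Z = Comp D (Fo X) (Fo Y) (Fo Z)"
  shows "cat_isomorphism C D Fo (\<lambda>X Y f. f)"
proof -
  interpret D: category D by fact
  interpret C: category C
    by unfold_locales
      (use Fo D.Ident_in_Hom D.Comp_in_Hom D.Comp_Ident_right D.Comp_Ident_left D.Comp_assoc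
        in \<open>simp_all add: Hom Ident Comp\<close>)
  have "cat_functor C D Fo (\<lambda>X Y f. f)"
    by unfold_locales (simp_all add: Fo Hom Ident Comp)
  \<comment> \<open>Through \<open>FG\<close>, \<open>Hom C (Go X) (Go Y)\<close> rewrites to
    \<open>Hom D X Y\<close>, and likewise for identities and composition.\<close>
  moreover have "cat_functor D C Go (\<lambda>X Y f. f)"
    by unfold_locales (simp_all add: Go Hom Ident Comp FG)
  ultimately show ?thesis
    unfolding cat_isomorphism_def using GF FG by blast
qed

theorem corollary4p37:
  shows "cat_isomorphism
           (convex_ordered_locale_cat :: ('a ordered_loc, 'a \<Rightarrow> 'a) cat)
           (op_cat (reflective_biframe_cat :: ('a biframe_triple, 'a \<Rightarrow> 'a) cat))
           (\<lambda>X. (fst X, im_up X, im_down X))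
           inverse_image"
proof -
  have Ob_C: "X \<in> Ob convex_ordered_locale_cat \<longleftrightarrow> good_ordered_locale X" for X :: "'a ordered_loc"
    by (simp add: convex_ordered_locale_cat_def)
  have Ob_D: "B \<in> Ob (op_cat reflective_biframe_cat) \<longleftrightarrow> biframe B \<and> reflective B"
    for B :: "'a biframe_triple"
    by (simp add: op_cat_def reflective_biframe_cat_def)
  \<comment> \<open>The action on arrows is first taken to be the identity function;
    \<open>inverse_image\<close> equals it by the encoding of locale maps.\<close>
  have "cat_isomorphism convex_ordered_locale_cat (op_cat reflective_biframe_cat)
      (biframe_of :: 'a ordered_loc \<Rightarrow> _) (\<lambda>X Y f. f)"
  proof (rule cat_isomorphism_if_Homs_equal[where Go = ordered_locale_of])
    show "category (op_cat reflective_biframe_cat)"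
      by (rule category_op_cat[OF category_reflective_biframe_cat])
    fix X Y Z :: "'a ordered_loc"
    assume X: "X \<in> Ob convex_ordered_locale_cat"
    then show "biframe_of X \<in> Ob (op_cat reflective_biframe_cat)"
      unfolding Ob_C Ob_D using biframe_of_reflective by blast
    show "ordered_locale_of (biframe_of X) = X"
      using X unfolding Ob_C by (rule ordered_locale_of_biframe_of)
    show "Ident convex_ordered_locale_cat X = Ident (op_cat reflective_biframe_cat) (biframe_of X)"
      by (simp add: convex_ordered_locale_cat_def op_cat_def reflective_biframe_cat_def)
    assume Y: "Y \<in> Ob convex_ordered_locale_cat"
    show "Hom convex_ordered_locale_cat X Y =
        Hom (op_cat reflective_biframe_cat) (biframe_of X) (biframe_of Y)"
      using X Y by (rule Hom_biframe_of)
    show "Comp convex_ordered_locale_cat X Y Z =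
        Comp (op_cat reflective_biframe_cat) (biframe_of X) (biframe_of Y) (biframe_of Z)"
      by (simp add: convex_ordered_locale_cat_def op_cat_def reflective_biframe_cat_def)
  next
    fix B :: "'a biframe_triple"
    assume "B \<in> Ob (op_cat reflective_biframe_cat)"
    then have "biframe B" "reflective B" unfolding Ob_D by auto
    then show "ordered_locale_of B \<in> Ob convex_ordered_locale_cat"
      "biframe_of (ordered_locale_of B) = B"
      unfolding Ob_C by (rule good_ordered_locale_of, rule biframe_of_ordered_locale_of)
  qed
  moreover have "inverse_image = (\<lambda>X Y f. f :: 'a \<Rightarrow> 'a)"
    by (simp add: inverse_image_def fun_eq_iff)
  ultimately show ?thesis by simp
qed

end
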